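(* Let $d_w>2$ and let $(X,d,\mu)$ be a compact metric measure space with $\mu$ a positive doubling Radon measure, let $0<Q<\infty$ be an exponent such that for some constant $C>0$, $\frac{\mu(B(x,R))}{\mu(B(x,r))}\le C\left(\frac{R}{r}\right)^Q$ for all $x\in X$ and $0<r\le R$, and assume the 2-Poincaré inequality with Korevaar–Schoen energies (P) stated in the context. Assume $Q>d_w$. Then any sequence $\{f_n\}_{n\ge1}\subset KS^{d_w/2,2}(X)$ such that $$\sup_{n\ge1}\Big(\|f_n\|_{L^2(X,\mu)}+\liminf_{r\to0^+}E_{d_w/2,X}(f_n,r)\Big)<+\infty$$ contains a subsequence that converges in $L^\alpha(X,\mu)$ for any $1\le\alpha<\frac{2Q}{Q-d_w}$.
   Context: $B(x,r)$ denotes the open ball. Positive and doubling: there is $C>0$ with $0<\mu(B(x,2r))\le C\mu(B(x,r))<\infty$ for all $x\in X$, $r>0$ (this implies that an exponent $Q$ as in the statement exists). For a Borel set $U\subseteq X$, $r>0$ and $f\in L^2(X,\mu)$, $$E_{d_w/2,U}(f,r):=\int_U\frac{1}{\mu(B(x,r))}\int_{B(x,r)}\frac{|f(y)-f(x)|^2}{r^{d_w}}\,d\mu(y)\,d\mu(x),$$ and $KS^{d_w/2,2}(X)=\{f\in L^2(X,\mu):\limsup_{r\to0^+}E_{d_w/2,X}(f,r)<+\infty\}$. (P) There are $C>0$, $\lambda\ge1$ such that for all $f\in KS^{d_w/2,2}(X)$, $x\in X$, $R>0$: $\int_{B(x,R)}|f(y)-f_{B(x,R)}|^2d\mu(y)\le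 CR^{d_w}\liminf_{r\to0^+}E_{d_w/2,B(x,\lambda R)}(f,r)$, where $f_{B(x,R)}=\frac{1}{\mu(B(x,R))}\int_{B(x,R)}f\,d\mu$. *)

theory Defs
  imports "HOL-Analysis.Analysis"
begin

text \<open>The metric space is a type of class \<^class>\<open>metric_space\<close>; measures live on its Borel sets.\<close>

definition radon_measure :: "'a::topological_space measure \<Rightarrow> bool" where
  "radon_measure M \<longleftrightarrow>
     sets M = sets borel \<and>
     (\<forall>K. compact K \<longrightarrow> emeasure M K < \<infinity>) \<and>
     (\<forall>B\<in>sets borel. emeasure M B = (SUP K\<in>{K. compact K \<and> K \<subseteq> B}. emeasure M K))"

definition positive_doubling :: "'a::metric_space measure \<Rightarrow> bool" where
  "positive_doubling M \<longleftrightarrow>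
     (\<exists>C::real. C > 0 \<and> (\<forall>x r. r > 0 \<longrightarrow>
        0 < emeasure M (ball x (2 * r)) \<and>
        emeasure M (ball x (2 * r)) \<le> ennreal C * emeasure M (ball x r) \<and>
        ennreal C * emeasure M (ball x r) < \<infinity>))"

text \<open>The real-valued \<^const>\<open>measure\<close> is harmless below: it is only used together with
  \<^const>\<open>positive_doubling\<close>, under which every ball has positive finite measure.\<close>

definition volume_growth_exponent :: "'a::metric_space measure \<Rightarrow> real \<Rightarrow> bool" where
  "volume_growth_exponent M Q \<longleftrightarrow>
     (\<exists>C::real. C > 0 \<and> (\<forall>x r R. 0 < r \<and> r \<le> R \<longrightarrow>
        measure M (ball x R) / measure M (ball x r) \<le> C * (R / r) powr Q))"

text \<open>Elements of Lebesgue spaces are represented by functions rather than by classes modulo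
  equality almost everywhere; all notions below are invariant under null-set changes.\<close>

definition Lp_space :: "'a measure \<Rightarrow> real \<Rightarrow> ('a \<Rightarrow> real) set" where
  "Lp_space M p = {f \<in> borel_measurable M. integrable M (\<lambda>x. \<bar>f x\<bar> powr p)}"

definition Lp_norm :: "'a measure \<Rightarrow> real \<Rightarrow> ('a \<Rightarrow> real) \<Rightarrow> real" where
  "Lp_norm M p f = (\<integral>x. \<bar>f x\<bar> powr p \<partial>M) powr (1 / p)"

text \<open>Membership of all terms and of the limit is required explicitly, since the Bochner integral
  of a non-integrable function is 0.\<close>

definition converges_in_Lp :: "'a measure \<Rightarrow> real \<Rightarrow> (nat \<Rightarrow> 'a \<Rightarrow> real) \<Rightarrow> bool" where
  "converges_in_Lp M p g \<longleftrightarrow>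
     (\<forall>n. g n \<in> Lp_space M p) \<and>
     (\<exists>h\<in>Lp_space M p. (\<lambda>n. Lp_norm M p (\<lambda>x. g n x - h x)) \<longlonglongrightarrow> 0)"

text \<open>The Korevaar--Schoen energy may be infinite, so it takes values in \<^typ>\<open>ennreal\<close>.\<close>

definition ks_energy ::
    "'a::metric_space measure \<Rightarrow> real \<Rightarrow> 'a set \<Rightarrow> ('a \<Rightarrow> real) \<Rightarrow> real \<Rightarrow> ennreal" where
  "ks_energy M dw U f r =
     (\<integral>\<^sup>+x\<in>U. (1 / emeasure M (ball x r) *
        (\<integral>\<^sup>+y\<in>ball x r. ennreal (\<bar>f y - f x\<bar>\<^sup>2 / r powr dw) \<partial>M)) \<partial>M)"

definition ks_space :: "'a::metric_space measure \<Rightarrow> real \<Rightarrow> ('a \<Rightarrow> real) set" where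
  "ks_space M dw = {f \<in> Lp_space M 2. Limsup (at_right 0) (ks_energy M dw UNIV f) < \<infinity>}"

definition ball_average :: "'a::metric_space measure \<Rightarrow> ('a \<Rightarrow> real) \<Rightarrow> 'a \<Rightarrow> real \<Rightarrow> real" where
  "ball_average M f x R = 1 / measure M (ball x R) * (\<integral>y\<in>ball x R. f y \<partial>M)"

definition ks_poincare :: "'a::metric_space measure \<Rightarrow> real \<Rightarrow> bool" where
  "ks_poincare M dw \<longleftrightarrow>
     (\<exists>C lam::real. C > 0 \<and> lam \<ge> 1 \<and> (\<forall>f\<in>ks_space M dw. \<forall>x R. R > 0 \<longrightarrow>
        (\<integral>\<^sup>+y\<in>ball x R. ennreal (\<bar>f y - ball_average M f x R\<bar>\<^sup>2) \<partial>M)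
          \<le> ennreal (C * R powr dw) *
             Liminf (at_right 0) (ks_energy M dw (ball x (lam * R)) f)))"

end

theory Submission
  imports Defs
begin

text \<open>Let \<open>E\<close> bound the squared \<open>L\<^sup>2\<close>-norms and the energies of the functions \<open>f\<close> considered.
  Since lower limits are superadditive, summing the Poincare inequality over a maximal
  \<open>R\<close>-separated net, whose dilated balls have bounded overlap, shows that \<open>f\<close> is within \<open>K R powr dw E\<close>
  in squared \<open>L\<^sup>2\<close>-norm of its averages over the balls of the net. As each net is finite and the averages are
  bounded, a subsequence along which all of them converge is Cauchy in \<open>L\<^sup>1\<close>.

  Averages over balls of radius \<open>1 / 2 ^ k\<close> are at most a multiple of \<open>q ^ k\<close> with
  \<open>q = 2 powr ((Q - dw) / 2)\<close>, by telescoping over concentric balls. Hence the integral of \<open>f\<^sup>2\<close> over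
  \<open>{\<bar>f\<bar> > A q ^ k}\<close> decays like \<open>2 powr (- k dw)\<close>, and summing over \<open>k\<close> bounds \<open>f\<close> in \<open>L\<^sup>p\<close> for
  \<open>2 < p < 2 Q / (Q - dw)\<close>. Almost everywhere convergence together with a bound in \<open>L\<^sup>p\<close> gives
  convergence in \<open>L\<^sup>\<alpha>\<close> for \<open>\<alpha> < p\<close>.\<close>

subsection \<open>Superadditivity of lower limits and lower integrals\<close>

lemma ennreal_SUP_add_SUP_le:
  fixes f :: "'b \<Rightarrow> ennreal" and g :: "'c \<Rightarrow> ennreal"
  assumes "A \<noteq> {}" "B \<noteq> {}" and le: "\<And>a b. a \<in> A \<Longrightarrow> b \<in> B \<Longrightarrow> f a + g b \<le> c"
  shows "(SUP a\<in>A. f a) + (SUP b\<in>B. g b) \<le> c"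
proof -
  have "(SUP a\<in>A. f a) + (SUP b\<in>B. g b) = (SUP a\<in>A. f a + (SUP b\<in>B. g b))"
    using assms(1) by (rule ennreal_SUP_add_left[symmetric])
  also have "\<dots> = (SUP a\<in>A. SUP b\<in>B. f a + g b)"
    using assms(2) by (simp add: ennreal_SUP_add_right)
  also have "\<dots> \<le> c"
    by (intro SUP_least le)
  finally show ?thesis .
qed

text \<open>Two lower bounds, each valid eventually, hold together eventually, and their sum bounds
  the sum of the functions from below. This lets energies on different balls be added at a common
  radius.\<close>

lemma ennreal_Liminf_add_le:
  fixes f g :: "'b \<Rightarrow> ennreal"
  shows "Liminf F f + Liminf F g \<le> Liminf F (\<lambda>x. f x + g x)"
  unfolding Liminf_def[of F f] Liminf_def[of F g]
proof (rule ennreal_SUP_add_SUP_le)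
  fix P P' assume "P \<in> {P. eventually P F}" "P' \<in> {P. eventually P F}"
  then have "eventually (\<lambda>x. P x \<and> P' x) F"
    by (simp add: eventually_conj)
  then have "(INF x\<in>Collect (\<lambda>x. P x \<and> P' x). f x + g x) \<le> Liminf F (\<lambda>x. f x + g x)"
    unfolding Liminf_def by (auto intro!: SUP_upper2)
  moreover have "Inf (f ` Collect P) + Inf (g ` Collect P') \<le> (INF x\<in>Collect (\<lambda>x. P x \<and> P' x). f x + g x)"
    by (intro INF_greatest add_mono INF_lower) auto
  ultimately show "Inf (f ` Collect P) + Inf (g ` Collect P') \<le> Liminf F (\<lambda>x. f x + g x)"
    by (rule order_trans[rotated])
qed (auto intro: eventually_True)

lemma ennreal_Liminf_sum_le:
  fixes f :: "'c \<Rightarrow> 'b \<Rightarrow> ennreal"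
  shows "(\<Sum>i\<in>I. Liminf F (f i)) \<le> Liminf F (\<lambda>x. \<Sum>i\<in>I. f i x)"
proof (induction I rule: infinite_finite_induct)
  case (insert i I)
  then show ?case
    using order_trans[OF add_left_mono[OF insert.IH] ennreal_Liminf_add_le[of F "f i"]] by simp
qed auto

text \<open>Without measurability, \<^const>\<open>nn_integral\<close> is a lower integral, which is still
  superadditive and positively homogeneous. This avoids a discussion of the measurability of the
  integrand of \<^const>\<open>ks_energy\<close>.\<close>

lemma nn_integral_superadditive: "integral\<^sup>N M f + integral\<^sup>N M g \<le> (\<integral>\<^sup>+x. f x + g x \<partial>M)"
  unfolding nn_integral_def[of M f] nn_integral_def[of M g]
proof (rule ennreal_SUP_add_SUP_le)
  fix u v assume "u \<in> {u. simple_function M u \<and> u \<le> f}" "v \<in> {v. simple_function M v \<and> v \<le> g}"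
  then have uv: "simple_function M u" "u \<le> f" "simple_function M v" "v \<le> g"
    by auto
  have "integral\<^sup>S M u + integral\<^sup>S M v = (\<integral>\<^sup>+x. u x + v x \<partial>M)"
    using uv by (simp add: nn_integral_eq_simple_integral nn_integral_add borel_measurable_simple_function)
  also have "\<dots> \<le> (\<integral>\<^sup>+x. f x + g x \<partial>M)"
    using uv by (intro nn_integral_mono add_mono) (auto simp: le_fun_def)
  finally show "integral\<^sup>S M u + integral\<^sup>S M v \<le> (\<integral>\<^sup>+x. f x + g x \<partial>M)" .
qed (auto simp: le_fun_def intro!: exI[of _ "\<lambda>_. 0"])

lemma nn_integral_sum_superadditive: "(\<Sum>i\<in>I. integral\<^sup>N M (f i)) \<le> (\<integral>\<^sup>+x. (\<Sum>i\<in>I. f i x) \<partial>M)"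
proof (induction I rule: infinite_finite_induct)
  case (insert i I)
  then show ?case
    using order_trans[OF add_left_mono[OF insert.IH] nn_integral_superadditive[of M "f i"]] by simp
qed auto

text \<open>A simple function below \<open>of_nat N * g\<close>, divided by \<open>N\<close>, is a
  simple function below \<open>g\<close>, so measurability of \<open>g\<close> never enters.\<close>

lemma nn_integral_of_nat_mult_le: "(\<integral>\<^sup>+x. of_nat N * g x \<partial>M) \<le> of_nat N * integral\<^sup>N M g"
proof (cases "N = 0")
  case False
  show ?thesis
    unfolding nn_integral_def[of M "\<lambda>x. of_nat N * g x"]
  proof (rule SUP_least)
    fix u assume "u \<in> {u. simple_function M u \<and> u \<le> (\<lambda>x. of_nat N * g x)}"
    then have u: "simple_function M u" "\<And>x. u x \<le> of_nat N * g x"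
      by (auto simp: le_fun_def)
    \<comment> \<open>Cancellation in \<open>ennreal\<close> is legitimate because \<open>N\<close>
      is neither zero nor infinite.\<close>
    have N: "of_nat N * (a / of_nat N) = a" for a :: ennreal
      using False ennreal_mult_divide_eq[of "of_nat N" a] by (simp add: ennreal_times_divide mult.commute)
    have [measurable]: "u \<in> borel_measurable M"
      using u by (simp add: borel_measurable_simple_function)
    have "integral\<^sup>S M u = (\<integral>\<^sup>+x. of_nat N * (u x / of_nat N) \<partial>M)"
      using u by (simp add: nn_integral_eq_simple_integral N)
    also have "\<dots> = of_nat N * (\<integral>\<^sup>+x. u x / of_nat N \<partial>M)"
      by (rule nn_integral_cmult) measurable
    also have "\<dots> \<le> of_nat N * integral\<^sup>N M g"
      using u False by (intro mult_left_mono nn_integral_mono)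
        (auto simp: divide_le_posI_ennreal mult.commute)
    finally show "integral\<^sup>S M u \<le> of_nat N * integral\<^sup>N M g" .
  qed
qed simp

text \<open>After the sum is moved inside the integral, the value \<open>g y\<close> is counted once
  for each set containing \<open>y\<close>. With \<open>g\<close> constant this bounds total volume,
  with the energy integrand total energy.\<close>

lemma nn_integral_sum_overlap_le:
  assumes "finite F" and overlap: "\<And>y. card {i\<in>F. y \<in> B i} \<le> N"
  shows "(\<Sum>i\<in>F. \<integral>\<^sup>+y\<in>B i. g y \<partial>M) \<le> of_nat N * integral\<^sup>N M g"
proof -
  have "(\<Sum>i\<in>F. g y * indicator (B i) y) = of_nat (card {i\<in>F. y \<in> B i}) * g y" for y
    using assms(1) by (simp add: sum_distrib_left[symmetric] indicator_def sum.If_cases Int_def mult.commute)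
  then have "(\<Sum>i\<in>F. g y * indicator (B i) y) \<le> of_nat N * g y" for y
    using overlap[of y] by (simp add: mult_right_mono)
  then show ?thesis
    by (intro order_trans[OF nn_integral_sum_superadditive]
        order_trans[OF nn_integral_mono nn_integral_of_nat_mult_le])
qed

subsection \<open>Nets in spaces with polynomial volume growth\<close>

text \<open>The volume bound is kept with a fixed constant and without division. It serves both for
  counting overlaps and for bounding the volume of small balls from below.\<close>

locale ball_growth_space = finite_measure M for M :: "'a::metric_space measure" +
  fixes Q G :: real
  assumes sets_M [measurable_cong]: "sets M = sets borel"
    and compact_UNIV: "compact (UNIV :: 'a set)"
    and ball_pos: "0 < r \<Longrightarrow> 0 < measure M (ball x r)"
    and growth: "0 < r \<Longrightarrow> r \<le> R \<Longrightarrow> measure M (ball x R) \<le> G * (R / r) powr Q * measure M (ball x r)"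
    and G_pos: "0 < G"
begin

lemma space_M [simp]: "space M = UNIV"
  using sets_eq_imp_space_eq[OF sets_M] by simp

lemma ball_in_sets [measurable, simp]: "ball x r \<in> sets M"
  by (simp add: sets_M)

text \<open>By compactness some ball radius exhausts the space; \<open>growth\<close> then compares
  every small ball with the whole space.\<close>

lemma ball_measure_lower_bound:
  "\<exists>c>0. \<forall>x r. 0 < r \<and> r \<le> 1 \<longrightarrow> c * r powr Q \<le> measure M (ball x r)"
proof -
  obtain D where D: "\<And>x y :: 'a. dist x y \<le> D"
    using compact_imp_bounded[OF compact_UNIV] unfolding bounded_any_center[of _ undefined]
    by (metis UNIV_I bounded_two_points compact_UNIV compact_imp_bounded)
  \<comment> \<open>\<open>D'\<close> exceeds all distances, so the open ball of this radius is
    everything, and it is at least 1, so \<open>growth\<close> applies to every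
    \<open>r \<le> 1\<close>.\<close>
  define D' where "D' = \<bar>D\<bar> + 1"
  have D': "ball x D' = UNIV" for x :: 'a
    using D[of x] by (auto simp: D'_def) (smt (verit) D)
  have pos: "0 < D'" "0 < measure M UNIV"
    using ball_pos[of D'] D' by (auto simp: D'_def)
  define c where "c = measure M UNIV / (G * D' powr Q)"
  show ?thesis
  proof (intro exI conjI allI impI)
    show "0 < c"
      using pos G_pos by (simp add: c_def)
    fix x :: 'a and r :: real assume r: "0 < r \<and> r \<le> 1"
    have "r \<le> D'"
      using r abs_ge_zero[of D] unfolding D'_def by linarith
    have "measure M UNIV \<le> G * (D' / r) powr Q * measure M (ball x r)"
      using growth[of r D' x] r \<open>r \<le> D'\<close> by (simp add: D')
    also have "\<dots> = G * D' powr Q * measure M (ball x r) / r powr Q"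
      using pos r by (simp add: powr_divide)
    finally show "c * r powr Q \<le> measure M (ball x r)"
      using pos G_pos r by (simp add: c_def field_simps)
  qed
qed

text \<open>A ball of radius \<open>R / 2\<close> contains at most one point of an
  \<open>R\<close>-separated set, so a finite cover by such balls bounds the cardinality of
  separated sets. One of greatest cardinality covers, since an uncovered point could be
  added.\<close>

lemma separated_net:
  assumes R: "0 < R"
  obtains F :: "'a set" where "finite F" "(\<Union>x\<in>F. ball x R) = UNIV"
    "\<And>x y. x \<in> F \<Longrightarrow> y \<in> F \<Longrightarrow> x \<noteq> y \<Longrightarrow> R \<le> dist x y"
proof -
  obtain F0 :: "'a set" where F0: "finite F0" "UNIV \<subseteq> (\<Union>x\<in>F0. ball x (R / 2))"
    using compactE_image[OF compact_UNIV, of UNIV "\<lambda>x. ball x (R / 2)"] R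
    by (metis UNIV_I UN_I centre_in_ball half_gt_zero open_ball subsetI)
  define S where "S F \<longleftrightarrow> finite F \<and> (\<forall>x\<in>F. \<forall>y\<in>F. x \<noteq> y \<longrightarrow> R \<le> dist x y)" for F :: "'a set"
  have bound: "card F \<le> card F0" if "S F" for F
  proof -
    obtain h where h: "\<And>y. h y \<in> F0 \<and> dist (h y) y < R / 2"
      using F0(2) by (auto simp: subset_eq) metis
    have "inj_on h F"
    proof (rule inj_onI, rule ccontr)
      fix x y assume "x \<in> F" "y \<in> F" "h x = h y" "x \<noteq> y"
      then have "R \<le> dist x y"
        using that by (auto simp: S_def)
      also have "dist x y \<le> dist (h x) x + dist (h y) y"
        using \<open>h x = h y\<close> dist_triangle3[of x y "h x"] by simp
      also have "\<dots> < R"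
        using h[of x] h[of y] by linarith
      finally show False by simp
    qed
    then show ?thesis
      using h F0(1) by (intro card_inj_on_le) auto
  qed
  obtain F where F: "S F" and max: "\<And>F'. S F' \<Longrightarrow> card F' \<le> card F"
    using ex_has_greatest_nat[of S "{}" card "Suc (card F0)"] bound
    by (force simp: S_def less_Suc_eq_le)
  have "y \<in> (\<Union>x\<in>F. ball x R)" for y
  proof (rule ccontr)
    assume y: "y \<notin> (\<Union>x\<in>F. ball x R)"
    then have "y \<notin> F"
      using R by auto
    have "S (insert y F)"
      using F y by (auto simp: S_def not_less dist_commute)
    from max[OF this] show False
      using \<open>y \<notin> F\<close> F by (simp add: S_def)
  qed
  then show ?thesis
    using F by (intro that[of F]) (auto simp: S_def)
qed

text \<open>Volume packing: the balls of radius \<open>R / 2\<close> about the counted centres are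
  disjoint and lie in the ball of radius \<open>(lam + 1) * R\<close> about \<open>y\<close>, while
  each carries a fixed fraction of the measure of that ball. The number \<open>4 * lam + 2\<close>
  is the ratio of the radii \<open>(2 * lam + 1) * R\<close> and \<open>R / 2\<close>.\<close>

lemma separated_overlap:
  fixes y :: 'a
  assumes R: "0 < R" and lam: "1 \<le> lam" and "finite F"
    and sep: "\<And>x y. x \<in> F \<Longrightarrow> y \<in> F \<Longrightarrow> x \<noteq> y \<Longrightarrow> R \<le> dist x y"
  shows "real (card {x\<in>F. y \<in> ball x (lam * R)}) \<le> G * (4 * lam + 2) powr Q"
proof -
  define S where "S = {x\<in>F. y \<in> ball x (lam * R)}"
  define m where "m = measure M (ball y ((lam + 1) * R))"
  have "finite S"
    using assms by (simp add: S_def)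
  have "m \<le> G * (4 * lam + 2) powr Q * measure M (ball x (R / 2))" if "x \<in> S" for x
  proof -
    have "ball y ((lam + 1) * R) \<subseteq> ball x ((2 * lam + 1) * R)"
    proof
      fix z assume "z \<in> ball y ((lam + 1) * R)"
      then show "z \<in> ball x ((2 * lam + 1) * R)"
        using that dist_triangle[of x z y] by (auto simp: S_def algebra_simps)
    qed
    then have "m \<le> measure M (ball x ((2 * lam + 1) * R))"
      unfolding m_def by (intro finite_measure_mono) auto
    also have "\<dots> \<le> G * (((2 * lam + 1) * R) / (R / 2)) powr Q * measure M (ball x (R / 2))"
      using R lam by (intro growth) (auto simp: field_simps)
    also have "((2 * lam + 1) * R) / (R / 2) = 4 * lam + 2"
      using R by (simp add: field_simps)
    finally show ?thesis .
  qed
  then have "real (card S) * m \<le> G * (4 * lam + 2) powr Q * (\<Sum>x\<in>S. measure M (ball x (R / 2)))"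
    unfolding sum_distrib_left by (rule sum_bounded_below)
  also have "(\<Sum>x\<in>S. measure M (ball x (R / 2))) = measure M (\<Union>x\<in>S. ball x (R / 2))"
  proof (rule finite_measure_finite_Union[symmetric, OF \<open>finite S\<close>])
    show "disjoint_family_on (\<lambda>x. ball x (R / 2)) S"
      unfolding disjoint_family_on_def
    proof (intro ballI impI equals0I)
      fix a b z assume "a \<in> S" "b \<in> S" "a \<noteq> b" "z \<in> ball a (R / 2) \<inter> ball b (R / 2)"
      then show False
        using sep[of a b] dist_triangle2[of a b z] by (auto simp: S_def)
    qed
  qed auto
  also have "\<dots> \<le> m"
    unfolding m_def
  proof (intro finite_measure_mono subsetI)
    fix z assume "z \<in> (\<Union>x\<in>S. ball x (R / 2))"
    then obtain x where "x \<in> S" "dist x z < R / 2"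
      by auto
    then show "z \<in> ball y ((lam + 1) * R)"
      using R dist_triangle3[of y z x] by (auto simp: S_def algebra_simps)
  qed auto
  finally have "real (card S) * m \<le> G * (4 * lam + 2) powr Q * m"
    using G_pos by (simp add: mult_left_mono)
  moreover have "0 < m"
    using R lam by (auto simp: m_def intro!: ball_pos)
  ultimately show ?thesis
    by (simp add: S_def)
qed

end

section \<open>Ball averages of square-integrable functions\<close>

context ball_growth_space
begin

lemma Lp_space_2_integrable:
  assumes "f \<in> Lp_space M 2"
  shows "f \<in> borel_measurable M" "integrable M (\<lambda>x. (f x)\<^sup>2)" "integrable M f"
proof -
  show [measurable]: "f \<in> borel_measurable M" and sq: "integrable M (\<lambda>x. (f x)\<^sup>2)"
    using assms by (auto simp: Lp_space_def)
  have "\<bar>t\<bar> \<le> 1 + t\<^sup>2" for t :: real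
    using sum_squares_bound[of "\<bar>t\<bar>" 1] abs_ge_zero[of t] unfolding power2_abs one_power2 mult_1_right
    by linarith
  then have "AE x in M. norm (f x) \<le> norm (1 + (f x)\<^sup>2)"
    by simp
  then show "integrable M f"
    using sq by (intro Bochner_Integration.integrable_bound[of M "\<lambda>x. 1 + (f x)\<^sup>2" f]
        Bochner_Integration.integrable_add) simp_all
qed

text \<open>Jensen's inequality, obtained by integrating
  \<open>t\<^sup>2 \<ge> 2 s t - s\<^sup>2\<close> with \<open>t = f y - c\<close> and \<open>s\<close> the mean of \<open>t\<close>.\<close>

lemma ball_average_square_le:
  assumes f: "f \<in> Lp_space M 2" and r: "0 < r"
  shows "ennreal ((ball_average M f x r - c)\<^sup>2 * measure M (ball x r))
    \<le> (\<integral>\<^sup>+y\<in>ball x r. ennreal ((f y - c)\<^sup>2) \<partial>M)"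
proof -
  note [measurable, simp] = Lp_space_2_integrable[OF f]
  let ?B = "ball x r" and ?s = "ball_average M f x r - c"
  let ?h = "\<lambda>y. indicator ?B y * (f y - c)\<^sup>2"
  have int: "integrable M (\<lambda>y. indicator ?B y * f y)"
    using integrable_mult_indicator[of ?B M f] by simp
  have intB: "integrable M (\<lambda>y. indicator ?B y :: real)"
    by (rule integrable_real_indicator) (simp_all add: less_top[symmetric])
  have "integrable M (\<lambda>y. (f y - c)\<^sup>2)"
    unfolding power2_diff by (intro Bochner_Integration.integrable_add Bochner_Integration.integrable_diff) auto
  then have inth: "integrable M ?h"
    using integrable_mult_indicator[of ?B M "\<lambda>y. (f y - c)\<^sup>2"] by simp
  have avg: "(\<integral>y. indicator ?B y * f y \<partial>M) = ball_average M f x r * measure M ?B"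
    using ball_pos[OF r, of x] by (simp add: ball_average_def set_lebesgue_integral_def)
  have "?s\<^sup>2 * measure M ?B = 2 * ?s * (ball_average M f x r * measure M ?B) - (2 * ?s * c + ?s\<^sup>2) * measure M ?B"
    by (simp add: power2_eq_square algebra_simps)
  also have "\<dots> = (\<integral>y. 2 * ?s * (indicator ?B y * f y) - (2 * ?s * c + ?s\<^sup>2) * indicator ?B y \<partial>M)"
  proof -
    have "(\<integral>y. a * (indicator ?B y * f y) - b * indicator ?B y \<partial>M) =
        a * (ball_average M f x r * measure M ?B) - b * measure M ?B" for a b
      using int intB by (subst Bochner_Integration.integral_diff) (simp_all add: avg)
    then show ?thesis ..
  qed
  also have "\<dots> \<le> (\<integral>y. ?h y \<partial>M)"
  proof (rule integral_mono[OF _ inth])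
    fix y
    have "0 \<le> ((f y - c) - ?s)\<^sup>2"
      by simp
    then show "2 * ?s * (indicator ?B y * f y) - (2 * ?s * c + ?s\<^sup>2) * indicator ?B y \<le> ?h y"
      by (auto simp: power2_eq_square algebra_simps split: split_indicator)
  qed (intro Bochner_Integration.integrable_diff integrable_mult_right int intB)
  also have "ennreal (\<integral>y. ?h y \<partial>M) = (\<integral>\<^sup>+y. ennreal (?h y) \<partial>M)"
    using inth by (intro nn_integral_eq_integral[symmetric]) auto
  also have "\<dots> = (\<integral>\<^sup>+y\<in>ball x r. ennreal ((f y - c)\<^sup>2) \<partial>M)"
    by (intro nn_integral_cong) (auto split: split_indicator)
  finally show ?thesis
    by (simp add: ennreal_leI)
qed

lemma ks_energy_mono_set: "U \<subseteq> V \<Longrightarrow> ks_energy M dw U f r \<le> ks_energy M dw V f r"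
  unfolding ks_energy_def by (intro nn_integral_mono mult_left_mono) (auto split: split_indicator)

end

subsection \<open>From almost everywhere convergence to convergence in Lebesgue spaces\<close>

text \<open>A Vitali argument: the distance to the limit, truncated at height \<open>b\<close>, is
  handled by dominated convergence on the finite measure space, and the part above \<open>b\<close>
  is small uniformly in \<open>n\<close> by the bound on \<open>p\<close>-th powers.\<close>

lemma AE_Cauchy_imp_converges_in_Lp:
  fixes g :: "nat \<Rightarrow> 'a \<Rightarrow> real"
  assumes "finite_measure M" and [measurable]: "\<And>n. g n \<in> borel_measurable M"
    and bound: "\<And>n. (\<integral>\<^sup>+x. ennreal (\<bar>g n x\<bar> powr p) \<partial>M) \<le> ennreal B"
    and Cauchy: "AE x in M. Cauchy (\<lambda>n. g n x)"
    and \<alpha>: "1 \<le> \<alpha>" "\<alpha> < p"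
  shows "converges_in_Lp M \<alpha> g"
proof -
  interpret finite_measure M by fact
  define h where "h x = lim (\<lambda>n. g n x)" for x
  have [measurable]: "h \<in> borel_measurable M"
    unfolding h_def by measurable
  have lim: "AE x in M. (\<lambda>n. g n x) \<longlonglongrightarrow> h x"
    using Cauchy by eventually_elim (auto simp: h_def Cauchy_convergent_iff convergent_LIMSEQ_iff)
  \<comment> \<open>Fatou's lemma carries the bound over to the limit \<open>h\<close>.\<close>
  have "(\<integral>\<^sup>+x. ennreal (\<bar>h x\<bar> powr p) \<partial>M) = (\<integral>\<^sup>+x. liminf (\<lambda>n. ennreal (\<bar>g n x\<bar> powr p)) \<partial>M)"
  proof (rule nn_integral_cong_AE)
    show "AE x in M. ennreal (\<bar>h x\<bar> powr p) = liminf (\<lambda>n. ennreal (\<bar>g n x\<bar> powr p))"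
      using lim
    proof eventually_elim
      case (elim x)
      then have "(\<lambda>n. \<bar>g n x\<bar> powr p) \<longlonglongrightarrow> \<bar>h x\<bar> powr p"
        using \<alpha> by (intro tendsto_powr' tendsto_rabs tendsto_const) auto
      then have "(\<lambda>n. ennreal (\<bar>g n x\<bar> powr p)) \<longlonglongrightarrow> ennreal (\<bar>h x\<bar> powr p)"
        by (intro tendsto_ennrealI)
      from lim_imp_Liminf[OF _ this] show ?case
        by simp
    qed
  qed
  also have "\<dots> \<le> liminf (\<lambda>n. \<integral>\<^sup>+x. ennreal (\<bar>g n x\<bar> powr p) \<partial>M)"
    by (intro nn_integral_liminf) measurable
  also have "\<dots> \<le> liminf (\<lambda>n::nat. ennreal B)"
    using bound by (intro Liminf_mono always_eventually) auto
  finally have bound_h: "(\<integral>\<^sup>+x. ennreal (\<bar>h x\<bar> powr p) \<partial>M) \<le> ennreal B"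
    by (simp add: Liminf_const)
  have le1: "\<bar>t\<bar> powr \<alpha> \<le> 1 + \<bar>t\<bar> powr p" for t :: real
  proof (cases "\<bar>t\<bar> \<le> 1")
    case True
    then show ?thesis
      using \<alpha> powr_mono2[of \<alpha> "\<bar>t\<bar>" 1] by (smt (verit) powr_ge_zero powr_one_eq_one)
  next
    case False
    then show ?thesis
      using \<alpha> powr_mono[of \<alpha> p "\<bar>t\<bar>"] by linarith
  qed
  have intp: "integrable M (\<lambda>x. \<bar>u x\<bar> powr p)" and mem: "u \<in> Lp_space M \<alpha>"
    if [measurable]: "u \<in> borel_measurable M" and u: "(\<integral>\<^sup>+x. ennreal (\<bar>u x\<bar> powr p) \<partial>M) \<le> ennreal B" for u
  proof -
    show *: "integrable M (\<lambda>x. \<bar>u x\<bar> powr p)"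
      using u by (intro integrableI_bounded) (auto simp: le_less_trans)
    have "integrable M (\<lambda>x. \<bar>u x\<bar> powr \<alpha>)"
      by (rule Bochner_Integration.integrable_bound[of M "\<lambda>x. 1 + \<bar>u x\<bar> powr p"]) (auto intro!: * le1)
    then show "u \<in> Lp_space M \<alpha>"
      by (simp add: Lp_space_def)
  qed
  define d where "d n x = \<bar>g n x - h x\<bar>" for n x
  have [measurable]: "d n \<in> borel_measurable M" for n
    unfolding d_def by measurable
  have dp: "d n x powr p \<le> 2 powr p * (\<bar>g n x\<bar> powr p + \<bar>h x\<bar> powr p)" for n x
  proof -
    define m where "m = max \<bar>g n x\<bar> \<bar>h x\<bar>"
    have "d n x \<le> 2 * m"
      by (auto simp: d_def m_def)
    then have "d n x powr p \<le> (2 * m) powr p"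
      using \<alpha> by (intro powr_mono2) (auto simp: d_def)
    also have "\<dots> = 2 powr p * m powr p"
      by (rule powr_mult)
    also have "m powr p \<le> \<bar>g n x\<bar> powr p + \<bar>h x\<bar> powr p"
      by (auto simp: m_def max_def)
    finally show ?thesis
      by simp
  qed
  \<comment> \<open>\<open>B\<close> may be negative, in which case \<open>ennreal B\<close> is 0;
    hence the maximum with 0 in bounds for real integrals.\<close>
  define B' where "B' = 2 powr p * (2 * max B 0)"
  have le_B: "(\<integral>x. \<bar>u x\<bar> powr p \<partial>M) \<le> max B 0"
    if "u \<in> borel_measurable M" "(\<integral>\<^sup>+x. ennreal (\<bar>u x\<bar> powr p) \<partial>M) \<le> ennreal B" for u
    using that intp[OF that]
    by (subst integral_eq_nn_integral) (auto intro!: enn2real_leI simp: max_def ennreal_neg split: if_splits)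
  have intd: "integrable M (\<lambda>x. d n x powr p)" for n
    by (rule Bochner_Integration.integrable_bound[of M "\<lambda>x. 2 powr p * (\<bar>g n x\<bar> powr p + \<bar>h x\<bar> powr p)"])
      (auto intro!: intp bound bound_h dp)
  have dB: "(\<integral>x. d n x powr p \<partial>M) \<le> B'" for n
  proof -
    have "(\<integral>x. d n x powr p \<partial>M) \<le> (\<integral>x. 2 powr p * (\<bar>g n x\<bar> powr p + \<bar>h x\<bar> powr p) \<partial>M)"
      by (intro integral_mono intd dp) (auto intro!: intp bound bound_h)
    also have "\<dots> = 2 powr p * ((\<integral>x. \<bar>g n x\<bar> powr p \<partial>M) + (\<integral>x. \<bar>h x\<bar> powr p \<partial>M))"
      by (subst integral_mult_right_zero, subst Bochner_Integration.integral_add)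
        (auto intro!: intp bound bound_h)
    also have "\<dots> \<le> B'"
      unfolding B'_def mult_2[of "max B 0"]
      by (intro mult_left_mono add_mono le_B bound bound_h) auto
    finally show ?thesis .
  qed
  have intda: "integrable M (\<lambda>x. d n x powr \<alpha>)" for n
  proof (rule Bochner_Integration.integrable_bound[of M "\<lambda>x. 1 + d n x powr p"])
    show "AE x in M. norm (d n x powr \<alpha>) \<le> norm (1 + d n x powr p)"
      using le1[of "d n _"] by (auto simp: d_def)
  qed (auto intro!: intd)
  have "(\<lambda>n. \<integral>x. d n x powr \<alpha> \<partial>M) \<longlonglongrightarrow> 0"
  proof (rule LIMSEQ_I)
    fix e :: real assume e: "0 < e"
    \<comment> \<open>The exponent is negative, so a high level \<open>b\<close> makes the
      contribution from above \<open>b\<close> smaller than \<open>e / 2\<close> for all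
      \<open>n\<close> at once.\<close>
    have "((\<lambda>b. b powr (\<alpha> - p) * B') \<longlongrightarrow> 0 * B') at_top"
      using \<alpha> by (intro tendsto_mult tendsto_const tendsto_neg_powr filterlim_ident) auto
    then have "eventually (\<lambda>b. b powr (\<alpha> - p) * B' < e / 2) at_top"
      using e by (intro order_tendstoD(2)) auto
    then obtain b where b: "1 \<le> b" "b powr (\<alpha> - p) * B' < e / 2"
      using eventually_conj[OF _ eventually_ge_at_top[of 1]] by (metis (mono_tags, lifting) eventually_happens' trivial_limit_at_top_linorder)
    let ?c = "\<lambda>n x. min (d n x powr \<alpha>) (b powr \<alpha>)"
    have split: "d n x powr \<alpha> \<le> ?c n x + b powr (\<alpha> - p) * d n x powr p" for n x
    proof (cases "d n x \<le> b")
      case True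
      then have "d n x powr \<alpha> \<le> b powr \<alpha>"
        using \<alpha> by (intro powr_mono2) (auto simp: d_def)
      then show ?thesis
        by simp
    next
      case False
      then have "d n x powr \<alpha> = d n x powr (\<alpha> - p) * d n x powr p"
        by (simp flip: powr_add)
      also have "\<dots> \<le> b powr (\<alpha> - p) * d n x powr p"
        using False \<alpha> b by (intro mult_right_mono powr_mono2') auto
      finally show ?thesis
        by (smt (verit) powr_ge_zero)
    qed
    have intc: "integrable M (?c n)" for n
      by (rule Bochner_Integration.integrable_bound[of M "\<lambda>_. b powr \<alpha>"]) auto
    have "(\<lambda>n. \<integral>x. ?c n x \<partial>M) \<longlonglongrightarrow> (\<integral>x. 0 \<partial>M)"
    proof (rule integral_dominated_convergence[where w="\<lambda>_. b powr \<alpha>"])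
      show "AE x in M. (\<lambda>n. ?c n x) \<longlonglongrightarrow> 0"
        using lim
      proof eventually_elim
        case (elim x)
        then have "(\<lambda>n. d n x) \<longlonglongrightarrow> 0"
          unfolding d_def by (metis LIM_zero tendsto_rabs_zero)
        then have "(\<lambda>n. ?c n x) \<longlonglongrightarrow> min (0 powr \<alpha>) (b powr \<alpha>)"
          using \<alpha> by (intro tendsto_min tendsto_powr' tendsto_const) (auto simp: d_def)
        then show ?case
          by simp
      qed
    qed auto
    then have "eventually (\<lambda>n. (\<integral>x. ?c n x \<partial>M) < e / 2) sequentially"
      using e by (intro order_tendstoD(2)) auto
    then obtain n0 where n0: "\<And>n. n0 \<le> n \<Longrightarrow> (\<integral>x. ?c n x \<partial>M) < e / 2"
      by (auto simp: eventually_sequentially)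
    show "\<exists>n0. \<forall>n\<ge>n0. norm ((\<integral>x. d n x powr \<alpha> \<partial>M) - 0) < e"
    proof (intro exI allI impI)
      fix n assume "n0 \<le> n"
      have "(\<integral>x. d n x powr \<alpha> \<partial>M) \<le> (\<integral>x. ?c n x + b powr (\<alpha> - p) * d n x powr p \<partial>M)"
        by (intro integral_mono intda split) (auto intro!: intc intd)
      also have "\<dots> = (\<integral>x. ?c n x \<partial>M) + b powr (\<alpha> - p) * (\<integral>x. d n x powr p \<partial>M)"
        using intc intd by simp
      also have "\<dots> \<le> (\<integral>x. ?c n x \<partial>M) + b powr (\<alpha> - p) * B'"
        using dB by (simp add: mult_left_mono)
      also have "\<dots> < e"
        using n0[OF \<open>n0 \<le> n\<close>] b by simp
      finally show "norm ((\<integral>x. d n x powr \<alpha> \<partial>M) - 0) < e"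
        by (simp add: integral_nonneg_AE)
    qed
  qed
  then have "(\<lambda>n. (\<integral>x. d n x powr \<alpha> \<partial>M) powr (1 / \<alpha>)) \<longlonglongrightarrow> 0 powr (1 / \<alpha>)"
    using \<alpha> by (intro tendsto_powr' tendsto_const) (auto intro!: always_eventually integral_nonneg_AE)
  then have "(\<lambda>n. Lp_norm M \<alpha> (\<lambda>x. g n x - h x)) \<longlonglongrightarrow> 0"
    by (simp add: Lp_norm_def d_def)
  then show ?thesis
    unfolding converges_in_Lp_def using mem bound bound_h by (intro conjI allI bexI[of _ h]) auto
qed

subsection \<open>Functions of bounded Korevaar--Schoen energy\<close>

text \<open>The form in which (P) is used: dilation and overlap are absorbed into \<open>K\<close>,
  so only the energy on the whole space occurs, and \<open>L\<close> bounds the total volume of a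
  net independently of \<open>R\<close>. The condition \<open>1 < dw\<close> makes
  \<open>R powr (dw - 1)\<close> vanish as \<open>R\<close> tends to 0.\<close>

locale poincare_net_space = ball_growth_space M Q G for M :: "'a::metric_space measure" and Q G +
  fixes dw K L :: real
  assumes dw: "1 < dw" "dw < Q"
    and K_pos: "0 < K" and L_nonneg: "0 \<le> L"
    and poincare_ball: "0 < R \<Longrightarrow> f \<in> ks_space M dw \<Longrightarrow>
      (\<integral>\<^sup>+y\<in>ball x R. ennreal ((f y - ball_average M f x R)\<^sup>2) \<partial>M)
        \<le> ennreal (K * R powr dw) * Liminf (at_right 0) (ks_energy M dw UNIV f)"
    and poincare_net: "0 < R \<Longrightarrow> \<exists>F. finite F \<and> (\<Union>x\<in>F. ball x R) = UNIV \<and>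
      (\<Sum>x\<in>F. measure M (ball x R)) \<le> L \<and>
      (\<forall>f\<in>ks_space M dw.
        (\<Sum>x\<in>F. \<integral>\<^sup>+y\<in>ball x R. ennreal ((f y - ball_average M f x R)\<^sup>2) \<partial>M)
          \<le> ennreal (K * R powr dw) * Liminf (at_right 0) (ks_energy M dw UNIV f))"

context ball_growth_space
begin

text \<open>Both net bounds come from the overlap count for a separated net: applied to the constant
  1 it bounds the volumes, and applied to the energy integrand it bounds the sum of the local
  energies.\<close>

lemma ks_poincare_imp_net:
  assumes "ks_poincare M dw" "1 < dw" "dw < Q"
  shows "\<exists>K L. poincare_net_space M Q G dw K L"
proof -
  obtain C lam :: real where C: "0 < C" and lam: "1 \<le> lam" and
    poincare: "\<And>f x R. f \<in> ks_space M dw \<Longrightarrow> 0 < R \<Longrightarrow>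
      (\<integral>\<^sup>+y\<in>ball x R. ennreal ((f y - ball_average M f x R)\<^sup>2) \<partial>M)
        \<le> ennreal (C * R powr dw) * Liminf (at_right 0) (ks_energy M dw (ball x (lam * R)) f)"
    using assms(1) unfolding ks_poincare_def power2_abs by blast
  define N where "N = nat \<lfloor>G * (4 * lam + 2) powr Q\<rfloor>"
  let ?E = "\<lambda>f. Liminf (at_right 0) (ks_energy M dw UNIV f)"
  \<comment> \<open>The factor \<open>real N + 1\<close> is at least 1 whatever \<open>N\<close> is,
    so the same constant is positive and also serves for a single ball.\<close>
  have K: "ennreal (C * R powr dw) * (of_nat N * e) \<le> ennreal (C * (real N + 1) * R powr dw) * e" for R e
  proof -
    have "ennreal (C * R powr dw) * of_nat N = ennreal (C * real N * R powr dw)"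
      using C by (subst ennreal_of_nat_eq_real_of_nat, subst ennreal_mult[symmetric]) (auto simp: mult_ac)
    also have "\<dots> \<le> ennreal (C * (real N + 1) * R powr dw)"
      using C by (intro ennreal_leI mult_right_mono mult_left_mono) auto
    finally show ?thesis
      unfolding mult.assoc[symmetric] by (rule mult_right_mono) simp
  qed
  show ?thesis
  proof (intro exI)
    show "poincare_net_space M Q G dw (C * (real N + 1)) (real N * measure M UNIV)"
    proof unfold_locales
      show "1 < dw" "dw < Q" "0 < C * (real N + 1)" "0 \<le> real N * measure M UNIV"
        using C assms by auto
      fix R :: real assume R: "0 < R"
      show "(\<integral>\<^sup>+y\<in>ball x R. ennreal ((f y - ball_average M f x R)\<^sup>2) \<partial>M)
          \<le> ennreal (C * (real N + 1) * R powr dw) * ?E f" if "f \<in> ks_space M dw" for f x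
      proof -
        have "ennreal (C * R powr dw) * Liminf (at_right 0) (ks_energy M dw (ball x (lam * R)) f)
            \<le> ennreal (C * (real N + 1) * R powr dw) * ?E f"
          using C by (intro mult_mono ennreal_leI Liminf_mono always_eventually allI ks_energy_mono_set) auto
        then show ?thesis
          using poincare[OF that R, of x] by (rule order_trans[rotated])
      qed
      obtain F :: "'a set" where F: "finite F" "(\<Union>x\<in>F. ball x R) = UNIV"
        and sep: "\<And>x y. x \<in> F \<Longrightarrow> y \<in> F \<Longrightarrow> x \<noteq> y \<Longrightarrow> R \<le> dist x y"
        using separated_net[OF R] by blast
      have overlap: "card {x\<in>F. y \<in> ball x (lam * R)} \<le> N" for y
        unfolding N_def using separated_overlap[OF R lam F(1) sep] by (rule le_nat_floor)
      have "card {x\<in>F. y \<in> ball x R} \<le> N" for y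
      proof -
        have "R \<le> lam * R"
          using R lam by simp
        then have "card {x\<in>F. y \<in> ball x R} \<le> card {x\<in>F. y \<in> ball x (lam * R)}"
          using F(1) by (intro card_mono) auto
        also note overlap
        finally show ?thesis .
      qed
      from nn_integral_sum_overlap_le[OF F(1) this, where M=M and g="\<lambda>_. 1"]
      have "(\<Sum>x\<in>F. emeasure M (ball x R)) \<le> of_nat N * emeasure M UNIV"
        by simp
      then have vol: "(\<Sum>x\<in>F. measure M (ball x R)) \<le> real N * measure M UNIV"
        by (simp add: emeasure_eq_measure sum_nonneg ennreal_of_nat_eq_real_of_nat flip: ennreal_mult)
      have "(\<Sum>x\<in>F. \<integral>\<^sup>+y\<in>ball x R. ennreal ((f y - ball_average M f x R)\<^sup>2) \<partial>M)
          \<le> ennreal (C * (real N + 1) * R powr dw) * ?E f" if f: "f \<in> ks_space M dw" for f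
      proof -
        have cont: "continuous_on UNIV (\<lambda>x::ennreal. of_nat N * x)"
          by (intro ennreal_continuous_on_cmult continuous_on_id) (simp add: of_nat_less_top)
        have "(\<Sum>x\<in>F. \<integral>\<^sup>+y\<in>ball x R. ennreal ((f y - ball_average M f x R)\<^sup>2) \<partial>M)
          \<le> ennreal (C * R powr dw) * (\<Sum>x\<in>F. Liminf (at_right 0) (ks_energy M dw (ball x (lam * R)) f))"
          unfolding sum_distrib_left by (intro sum_mono poincare f R)
        also have "(\<Sum>x\<in>F. Liminf (at_right 0) (ks_energy M dw (ball x (lam * R)) f))
            \<le> Liminf (at_right 0) (\<lambda>r. \<Sum>x\<in>F. ks_energy M dw (ball x (lam * R)) f r)"
          by (rule ennreal_Liminf_sum_le)
        \<comment> \<open>For each fixed \<open>r\<close> the local energies integrate one and the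
          same integrand over the dilated balls, so the overlap count applies.\<close>
        also have "\<dots> \<le> Liminf (at_right 0) (\<lambda>r. of_nat N * ks_energy M dw UNIV f r)"
          using nn_integral_sum_overlap_le[OF F(1) overlap]
          by (intro Liminf_mono always_eventually allI) (simp add: ks_energy_def)
        also have "\<dots> = of_nat N * ?E f"
          by (rule Liminf_compose_continuous_mono[OF cont]) (auto intro!: monoI mult_left_mono)
        finally show ?thesis
          using K[of R "?E f"] by (meson mult_left_mono order_trans zero_le)
      qed
      with F vol show "\<exists>F. finite F \<and> (\<Union>x\<in>F. ball x R) = UNIV \<and>
        (\<Sum>x\<in>F. measure M (ball x R)) \<le> real N * measure M UNIV \<and>
        (\<forall>f\<in>ks_space M dw.
          (\<Sum>x\<in>F. \<integral>\<^sup>+y\<in>ball x R. ennreal ((f y - ball_average M f x R)\<^sup>2) \<partial>M)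
            \<le> ennreal (C * (real N + 1) * R powr dw) * ?E f)"
        by blast
    qed
  qed
qed

end

section \<open>Growth of averages and higher integrability\<close>

context poincare_net_space
begin

definition bounded_energy :: "real \<Rightarrow> ('a \<Rightarrow> real) set" where
  "bounded_energy E = {f \<in> ks_space M dw. (\<integral>\<^sup>+x. ennreal ((f x)\<^sup>2) \<partial>M) \<le> ennreal E \<and>
     Liminf (at_right 0) (ks_energy M dw UNIV f) \<le> ennreal E}"

lemma bounded_energyD:
  assumes "f \<in> bounded_energy E"
  shows "f \<in> ks_space M dw" "f \<in> Lp_space M 2" "f \<in> borel_measurable M" "integrable M f"
    "(\<integral>\<^sup>+x. ennreal ((f x)\<^sup>2) \<partial>M) \<le> ennreal E"
    "Liminf (at_right 0) (ks_energy M dw UNIV f) \<le> ennreal E"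
  using assms by (auto simp: bounded_energy_def ks_space_def intro: Lp_space_2_integrable)

lemma bounded_energy_ball:
  assumes "f \<in> bounded_energy E" "0 < R" "0 \<le> E"
  shows "(\<integral>\<^sup>+y\<in>ball x R. ennreal ((f y - ball_average M f x R)\<^sup>2) \<partial>M) \<le> ennreal (K * R powr dw * E)"
proof -
  note f = bounded_energyD[OF assms(1)]
  have "(\<integral>\<^sup>+y\<in>ball x R. ennreal ((f y - ball_average M f x R)\<^sup>2) \<partial>M) \<le> ennreal (K * R powr dw) * ennreal E"
    using poincare_ball[OF assms(2) f(1), of x] f(6) by (meson mult_left_mono order_trans zero_le)
  then show ?thesis
    using K_pos assms by (simp add: ennreal_mult)
qed

lemma bounded_energy_net:
  assumes "0 < R" "0 \<le> E"
  shows "\<exists>F. finite F \<and> (\<Union>x\<in>F. ball x R) = UNIV \<and> (\<Sum>x\<in>F. measure M (ball x R)) \<le> L \<and>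
    (\<forall>f\<in>bounded_energy E.
      (\<Sum>x\<in>F. \<integral>\<^sup>+y\<in>ball x R. ennreal ((f y - ball_average M f x R)\<^sup>2) \<partial>M) \<le> ennreal (K * R powr dw * E))"
proof -
  obtain F where F: "finite F" "(\<Union>x\<in>F. ball x R) = UNIV" "(\<Sum>x\<in>F. measure M (ball x R)) \<le> L"
    and le: "\<And>f. f \<in> ks_space M dw \<Longrightarrow>
        (\<Sum>x\<in>F. \<integral>\<^sup>+y\<in>ball x R. ennreal ((f y - ball_average M f x R)\<^sup>2) \<partial>M)
          \<le> ennreal (K * R powr dw) * Liminf (at_right 0) (ks_energy M dw UNIV f)"
    using poincare_net[OF assms(1)] by blast
  have "(\<Sum>x\<in>F. \<integral>\<^sup>+y\<in>ball x R. ennreal ((f y - ball_average M f x R)\<^sup>2) \<partial>M) \<le> ennreal (K * R powr dw * E)"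
    if "f \<in> bounded_energy E" for f
  proof -
    note f = bounded_energyD[OF that]
    have "(\<Sum>x\<in>F. \<integral>\<^sup>+y\<in>ball x R. ennreal ((f y - ball_average M f x R)\<^sup>2) \<partial>M) \<le> ennreal (K * R powr dw) * ennreal E"
      using le[OF f(1)] f(6) by (meson mult_left_mono order_trans zero_le)
    then show ?thesis
      using K_pos assms by (simp add: ennreal_mult)
  qed
  with F show ?thesis
    by blast
qed

lemma half_power_powr: "(1 / 2 ^ k) powr z = 1 / (2 powr z) ^ k" for z :: real
proof -
  have "(2 ^ k) powr z = (2 powr z) ^ k" for z :: real
    by (simp add: powr_powr mult.commute flip: powr_realpow)
  then show ?thesis
    by (simp add: powr_divide)
qed

text \<open>At radius \<open>1 / 2 ^ k\<close> the oscillation bound is of order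
  \<open>(1 / 2 ^ k) powr dw\<close> and the volume at least of order
  \<open>(1 / 2 ^ k) powr Q\<close>; the square root of the quotient is
  \<open>q ^ k\<close>.\<close>

definition q :: real where "q = 2 powr ((Q - dw) / 2)"

lemma q_gt_1: "1 < q"
  using dw by (simp add: q_def)

lemma q_square: "q\<^sup>2 = 2 powr Q / 2 powr dw"
  by (simp add: q_def power2_eq_square flip: powr_add powr_diff)

text \<open>Averages over concentric balls of radii \<open>1 / 2 ^ k\<close> and \<open>1 / 2 ^ Suc k\<close> differ by at most a
  multiple of \<open>q ^ k\<close>, so the bound is a geometric sum.\<close>

lemma ball_average_bound:
  assumes "0 \<le> E"
  shows "\<exists>A>0. \<forall>f\<in>bounded_energy E. \<forall>x k. \<bar>ball_average M f x (1 / 2 ^ k)\<bar> \<le> A * q ^ k"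
proof -
  obtain c where c: "0 < c" "\<And>x r. 0 < r \<Longrightarrow> r \<le> 1 \<Longrightarrow> c * r powr Q \<le> measure M (ball x r)"
    using ball_measure_lower_bound by blast
  \<comment> \<open>\<open>D * q ^ k\<close> bounds the jump between consecutive averages; the
    factor \<open>2 powr Q\<close> arises because the smaller ball has radius
    \<open>1 / 2 ^ Suc k\<close>. The choice of \<open>A\<close> dominates the average at radius 1
    and gives \<open>D \<le> A * (q - 1)\<close>, which closes the induction; the summand 1 makes it
    positive.\<close>
  define D where "D = sqrt (K * E * 2 powr Q / c)"
  define A where "A = max (sqrt (E / c)) (D / (q - 1)) + 1"
  have D0: "0 \<le> D"
    using c K_pos assms by (simp add: D_def)
  have A0: "0 < A" "sqrt (E / c) \<le> A" "D \<le> A * (q - 1)"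
  proof -
    show "sqrt (E / c) \<le> A"
      by (simp add: A_def)
    have "0 \<le> D / (q - 1)"
      using D0 q_gt_1 by simp
    then show "0 < A"
      by (simp add: A_def)
    have "D / (q - 1) \<le> A"
      by (simp add: A_def)
    then show "D \<le> A * (q - 1)"
      using q_gt_1 by (simp add: field_simps)
  qed
  have "\<bar>ball_average M f x (1 / 2 ^ k)\<bar> \<le> A * q ^ k" if f: "f \<in> bounded_energy E" for f x k
  proof (induction k)
    case 0
    have "ennreal ((ball_average M f x 1 - 0)\<^sup>2 * measure M (ball x 1)) \<le> (\<integral>\<^sup>+y\<in>ball x 1. ennreal ((f y - 0)\<^sup>2) \<partial>M)"
      by (rule ball_average_square_le[OF bounded_energyD(2)[OF f]]) simp
    also have "\<dots> \<le> (\<integral>\<^sup>+y. ennreal ((f y)\<^sup>2) \<partial>M)"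
      by (intro nn_integral_mono) (auto split: split_indicator)
    also note bounded_energyD(5)[OF f]
    finally have "(ball_average M f x 1)\<^sup>2 * measure M (ball x 1) \<le> E"
      using assms by simp
    moreover have "(ball_average M f x 1)\<^sup>2 * c \<le> (ball_average M f x 1)\<^sup>2 * measure M (ball x 1)"
      using c(2)[of 1 x] by (intro mult_left_mono) auto
    ultimately have "(ball_average M f x 1)\<^sup>2 \<le> E / c"
      using c(1) by (simp add: field_simps)
    then have "\<bar>ball_average M f x 1\<bar> \<le> sqrt (E / c)"
      using real_sqrt_le_mono by fastforce
    then show ?case
      using A0 by simp
  next
    case (Suc k)
    let ?u = "\<lambda>k. ball_average M f x (1 / 2 ^ k)"
    let ?m = "measure M (ball x (1 / 2 ^ Suc k))"
    \<comment> \<open>Jensen on the smaller ball, with the average over the larger ball as the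
      constant; enlarging the domain then gives the oscillation that (P) controls.\<close>
    have "ennreal ((?u (Suc k) - ?u k)\<^sup>2 * ?m) \<le> (\<integral>\<^sup>+y\<in>ball x (1 / 2 ^ Suc k). ennreal ((f y - ?u k)\<^sup>2) \<partial>M)"
      by (rule ball_average_square_le[OF bounded_energyD(2)[OF f]]) simp
    also have "\<dots> \<le> (\<integral>\<^sup>+y\<in>ball x (1 / 2 ^ k). ennreal ((f y - ?u k)\<^sup>2) \<partial>M)"
    proof (intro nn_integral_mono mult_left_mono)
      have "ball x (1 / 2 ^ Suc k) \<subseteq> ball x (1 / 2 ^ k)"
        by (intro subset_ball) (simp add: field_simps)
      then show "indicator (ball x (1 / 2 ^ Suc k)) y \<le> (indicator (ball x (1 / 2 ^ k)) y :: ennreal)" for y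
        by (auto split: split_indicator)
    qed simp
    also have "\<dots> \<le> ennreal (K * (1 / 2 ^ k) powr dw * E)"
      by (rule bounded_energy_ball[OF f _ assms]) simp
    finally have "(?u (Suc k) - ?u k)\<^sup>2 * ?m \<le> K * E / (2 powr dw) ^ k"
      using K_pos assms by (simp add: half_power_powr)
    moreover have "(?u (Suc k) - ?u k)\<^sup>2 * (c / (2 powr Q) ^ Suc k) \<le> (?u (Suc k) - ?u k)\<^sup>2 * ?m"
    proof (rule mult_left_mono)
      have "1 / 2 ^ Suc k \<le> (1 :: real)"
        using one_le_power[of "2 :: real" "Suc k"] by (simp del: power_Suc)
      then show "c / (2 powr Q) ^ Suc k \<le> ?m"
        using c(2)[of "1 / 2 ^ Suc k" x] unfolding half_power_powr by simp
    qed simp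
    ultimately have "(?u (Suc k) - ?u k)\<^sup>2 * (c / (2 powr Q) ^ Suc k) \<le> K * E / (2 powr dw) ^ k"
      by linarith
    then have "(?u (Suc k) - ?u k)\<^sup>2 \<le> K * E * 2 powr Q / c * (2 powr Q / 2 powr dw) ^ k"
      using c(1) by (simp add: field_simps power_divide)
    also have "\<dots> = (D * q ^ k)\<^sup>2"
      using c(1) K_pos assms
      by (simp add: D_def power_mult_distrib q_square[symmetric] power_mult[symmetric] mult.commute)
    finally have "\<bar>?u (Suc k) - ?u k\<bar> \<le> D * q ^ k"
      using D0 q_gt_1 by (simp add: abs_le_square_iff[symmetric])
    also have "\<dots> \<le> A * (q - 1) * q ^ k"
      using A0 q_gt_1 by (intro mult_right_mono) auto
    finally have "\<bar>?u (Suc k)\<bar> \<le> A * q ^ k + A * (q - 1) * q ^ k"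
      using Suc.IH by linarith
    then show ?case
      by (simp add: algebra_simps)
  qed
  then show ?thesis
    using A0 by blast
qed

text \<open>Where \<open>\<bar>f\<bar>\<close> exceeds twice the bound on its averages over balls of radius \<open>1 / 2 ^ k\<close>, it is
  controlled by its oscillation on these balls.\<close>

lemma tail_bound:
  assumes E: "0 \<le> E"
  shows "\<exists>A>0. \<forall>f\<in>bounded_energy E. \<forall>k.
    (\<integral>\<^sup>+y\<in>{y. A * q ^ k < \<bar>f y\<bar>}. ennreal ((f y)\<^sup>2) \<partial>M) \<le> ennreal (4 * K * E / (2 powr dw) ^ k)"
proof -
  obtain A where A: "0 < A"
    "\<And>f x k. f \<in> bounded_energy E \<Longrightarrow> \<bar>ball_average M f x (1 / 2 ^ k)\<bar> \<le> A * q ^ k"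
    using ball_average_bound[OF E] by blast
  have "(\<integral>\<^sup>+y\<in>{y. 2 * A * q ^ k < \<bar>f y\<bar>}. ennreal ((f y)\<^sup>2) \<partial>M) \<le> ennreal (4 * K * E / (2 powr dw) ^ k)"
    if f: "f \<in> bounded_energy E" for f k
  proof -
    let ?R = "1 / 2 ^ k :: real" and ?T = "{y. 2 * A * q ^ k < \<bar>f y\<bar>}"
    note [measurable] = bounded_energyD(3)[OF f]
    have "0 < ?R"
      by simp
    from bounded_energy_net[OF this E] f obtain F where F: "finite F" "(\<Union>x\<in>F. ball x ?R) = UNIV"
      "(\<Sum>x\<in>F. \<integral>\<^sup>+y\<in>ball x ?R. ennreal ((f y - ball_average M f x ?R)\<^sup>2) \<partial>M) \<le> ennreal (K * ?R powr dw * E)"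
      by blast
    let ?g = "\<lambda>x y. ennreal ((f y - ball_average M f x ?R)\<^sup>2) * indicator (ball x ?R) y"
    \<comment> \<open>A value more than twice as large as the bound on the average is at most twice
      its distance from that average; squaring produces the factor 4.\<close>
    have far: "\<bar>t\<bar> \<le> 2 * \<bar>t - u\<bar>" if "2 * a < \<bar>t\<bar>" "\<bar>u\<bar> \<le> a" for a t u :: real
      using that by (smt (verit))
    have "(\<integral>\<^sup>+y\<in>?T. ennreal ((f y)\<^sup>2) \<partial>M) \<le> (\<integral>\<^sup>+y. 4 * (\<Sum>x\<in>F. ?g x y) \<partial>M)"
    proof (rule nn_integral_mono)
      fix y
      obtain x where x: "x \<in> F" "y \<in> ball x ?R"
        using F(2) by blast
      show "ennreal ((f y)\<^sup>2) * indicator ?T y \<le> 4 * (\<Sum>x\<in>F. ?g x y)"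
      proof (cases "y \<in> ?T")
        case True
        then have "\<bar>f y\<bar> \<le> 2 * \<bar>f y - ball_average M f x ?R\<bar>"
          using A(2)[OF f, of x k] far[of "A * q ^ k" "f y" "ball_average M f x ?R"]
          by (simp add: mult.assoc)
        then have "(f y)\<^sup>2 \<le> 4 * (f y - ball_average M f x ?R)\<^sup>2"
          using power_mono[of "\<bar>f y\<bar>" _ 2] by (fastforce simp: power_mult_distrib)
        then have "ennreal ((f y)\<^sup>2) \<le> 4 * ennreal ((f y - ball_average M f x ?R)\<^sup>2)"
          using ennreal_leI[of "(f y)\<^sup>2"] by (fastforce simp: ennreal_mult)
        also have "\<dots> = 4 * ?g x y"
          using x by simp
        also have "\<dots> \<le> 4 * (\<Sum>x\<in>F. ?g x y)"
          using F(1) x by (intro mult_left_mono member_le_sum) auto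
        finally show ?thesis
          using True by simp
      qed simp
    qed
    also have "\<dots> = 4 * (\<Sum>x\<in>F. \<integral>\<^sup>+y. ?g x y \<partial>M)"
      by (simp add: nn_integral_cmult nn_integral_sum)
    also have "\<dots> \<le> 4 * ennreal (K * ?R powr dw * E)"
      using F(3) by (rule mult_left_mono) simp
    also have "\<dots> = ennreal (4 * (K * ?R powr dw * E))"
      using K_pos E by (subst ennreal_mult) auto
    also have "4 * (K * ?R powr dw * E) = 4 * K * E / (2 powr dw) ^ k"
      unfolding half_power_powr by simp
    finally show ?thesis .
  qed
  then show ?thesis
    using A(1) by (intro exI[of _ "2 * A"]) auto
qed

text \<open>Where \<open>\<bar>f\<bar>\<close> lies between \<open>A * q ^ k\<close> and
  \<open>A * q ^ Suc k\<close>, its \<open>p\<close>-th power is at most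
  \<open>(A * q ^ Suc k) powr (p - 2)\<close> times its square. The tail bound turns the sum over
  \<open>k\<close> into a geometric series.\<close>

lemma Lp_bound:
  assumes E: "0 \<le> E" and p: "2 < p" "p < 2 * Q / (Q - dw)"
  shows "\<exists>B. \<forall>f\<in>bounded_energy E. (\<integral>\<^sup>+y. ennreal (\<bar>f y\<bar> powr p) \<partial>M) \<le> ennreal B"
proof -
  obtain A where A: "0 < A" and tail: "\<And>f k. f \<in> bounded_energy E \<Longrightarrow>
    (\<integral>\<^sup>+y\<in>{y. A * q ^ k < \<bar>f y\<bar>}. ennreal ((f y)\<^sup>2) \<partial>M) \<le> ennreal (4 * K * E / (2 powr dw) ^ k)"
    using tail_bound[OF E] by blast
  \<comment> \<open>The ratio of the series; \<open>\<rho> < 1\<close> says exactly that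
    \<open>p < 2 * Q / (Q - dw)\<close>.\<close>
  define \<rho> where "\<rho> = q powr (p - 2) / 2 powr dw"
  define C where "C = (A * q) powr (p - 2) * (4 * K * E)"
  have C: "0 \<le> C"
    using K_pos E by (simp add: C_def)
  have "\<rho> < 1"
  proof -
    have "p * (Q - dw) < 2 * Q"
      using p dw by (simp add: field_simps)
    then have "(Q - dw) / 2 * (p - 2) < dw"
      by (simp add: field_simps)
    then show ?thesis
      by (simp add: \<rho>_def q_def powr_powr)
  qed
  have \<rho>: "0 \<le> \<rho>"
    by (simp add: \<rho>_def)
  let ?c = "\<lambda>k. (A * q ^ Suc k) powr (p - 2)"
  have c: "?c k * (4 * K * E / (2 powr dw) ^ k) = C * \<rho> ^ k" for k
  proof -
    have "(q ^ k) powr (p - 2) = (q powr (p - 2)) ^ k"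
      using q_gt_1 by (simp add: powr_powr mult.commute flip: powr_realpow)
    moreover have "?c k = (A * q) powr (p - 2) * (q ^ k) powr (p - 2)"
      by (simp add: powr_mult mult.assoc)
    ultimately show ?thesis
      by (simp add: C_def \<rho>_def power_divide)
  qed
  have "(\<integral>\<^sup>+y. ennreal (\<bar>f y\<bar> powr p) \<partial>M) \<le> ennreal (A powr p * measure M UNIV + C / (1 - \<rho>))"
    if f: "f \<in> bounded_energy E" for f
  proof -
    note [measurable] = bounded_energyD(3)[OF f]
    let ?g = "\<lambda>k y. ennreal (?c k) * (ennreal ((f y)\<^sup>2) * indicator {y. A * q ^ k < \<bar>f y\<bar>} y)"
    have "(\<integral>\<^sup>+y. ennreal (\<bar>f y\<bar> powr p) \<partial>M) \<le> (\<integral>\<^sup>+y. ennreal (A powr p) + (\<Sum>k. ?g k y) \<partial>M)"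
    proof (rule nn_integral_mono)
      fix y
      show "ennreal (\<bar>f y\<bar> powr p) \<le> ennreal (A powr p) + (\<Sum>k. ?g k y)"
      proof (cases "\<bar>f y\<bar> \<le> A")
        case True
        then have "ennreal (\<bar>f y\<bar> powr p) \<le> ennreal (A powr p)"
          using p by (intro ennreal_leI powr_mono2) auto
        then show ?thesis
          by (rule order_trans) simp
      next
        case False
        \<comment> \<open>Since \<open>\<bar>f y\<bar>\<close> exceeds \<open>A\<close>, the least
          level \<open>l\<close> is not 0, and its predecessor \<open>k\<close> yields the one term
          of the series that is needed.\<close>
        define l where "l = (LEAST k. \<bar>f y\<bar> \<le> A * q ^ k)"
        obtain n where "\<bar>f y\<bar> / A < q ^ n"
          using real_arch_pow[OF q_gt_1] by blast
        then have "\<bar>f y\<bar> \<le> A * q ^ n"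
          using A by (simp add: field_simps)
        then have l: "\<bar>f y\<bar> \<le> A * q ^ l"
          unfolding l_def by (rule LeastI)
        then obtain k where k: "l = Suc k"
          using False by (cases l) auto
        then have gt: "A * q ^ k < \<bar>f y\<bar>"
          using not_less_Least[of k "\<lambda>k. \<bar>f y\<bar> \<le> A * q ^ k"] by (simp add: l_def)
        have "\<bar>f y\<bar> powr p = \<bar>f y\<bar> powr (p - 2) * \<bar>f y\<bar> powr 2"
          using powr_add[of "\<bar>f y\<bar>" "p - 2" 2] by simp
        also have "\<bar>f y\<bar> powr 2 = (f y)\<^sup>2"
          by simp
        also have "\<bar>f y\<bar> powr (p - 2) * (f y)\<^sup>2 \<le> ?c k * (f y)\<^sup>2"
          using l p unfolding k by (intro mult_right_mono powr_mono2) auto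
        finally have "ennreal (\<bar>f y\<bar> powr p) \<le> ?g k y"
          using gt by (simp add: ennreal_leI flip: ennreal_mult)
        also have "\<dots> = (\<Sum>j\<in>{k}. ?g j y)"
          by simp
        also have "\<dots> \<le> (\<Sum>j. ?g j y)"
          by (intro sum_le_suminf summableI) auto
        finally show ?thesis
          by (rule order_trans) simp
      qed
    qed
    also have "\<dots> = ennreal (A powr p) * emeasure M UNIV +
        (\<Sum>k. ennreal (?c k) * (\<integral>\<^sup>+y\<in>{y. A * q ^ k < \<bar>f y\<bar>}. ennreal ((f y)\<^sup>2) \<partial>M))"
      by (simp add: nn_integral_add nn_integral_suminf nn_integral_cmult)
    also have "\<dots> \<le> ennreal (A powr p) * emeasure M UNIV + (\<Sum>k. ennreal (C * \<rho> ^ k))"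
    proof (intro add_left_mono suminf_le summableI)
      fix k
      have "ennreal (?c k) * (\<integral>\<^sup>+y\<in>{y. A * q ^ k < \<bar>f y\<bar>}. ennreal ((f y)\<^sup>2) \<partial>M)
          \<le> ennreal (?c k) * ennreal (4 * K * E / (2 powr dw) ^ k)"
        by (intro mult_left_mono tail f) simp
      also have "\<dots> = ennreal (C * \<rho> ^ k)"
        unfolding c[symmetric] using K_pos E by (intro ennreal_mult[symmetric]) auto
      finally show "ennreal (?c k) * (\<integral>\<^sup>+y\<in>{y. A * q ^ k < \<bar>f y\<bar>}. ennreal ((f y)\<^sup>2) \<partial>M) \<le> ennreal (C * \<rho> ^ k)" .
    qed
    also have "(\<Sum>k. ennreal (C * \<rho> ^ k)) = ennreal (C / (1 - \<rho>))"
      using geometric_sums[of \<rho>] \<rho> \<open>\<rho> < 1\<close> C sums_mult[of "\<lambda>k. \<rho> ^ k" "1 / (1 - \<rho>)" C]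
      by (intro suminf_ennreal_eq) auto
    also have "ennreal (A powr p) * emeasure M UNIV + ennreal (C / (1 - \<rho>)) =
        ennreal (A powr p * measure M UNIV + C / (1 - \<rho>))"
      using C \<open>\<rho> < 1\<close> by (simp add: emeasure_eq_measure ennreal_mult)
    finally show ?thesis .
  qed
  then show ?thesis
    by blast
qed

section \<open>Compactness in the space of integrable functions\<close>

text \<open>The finite set depends only on \<open>R\<close> and \<open>E\<close>, so closeness of
  finitely many averages controls the distance of any two functions in
  \<open>bounded_energy E\<close>. Each function is compared with its average on a net ball
  containing the point.\<close>

lemma L1_distance_estimate:
  assumes R: "0 < R" and E: "0 \<le> E"
  shows "\<exists>F. finite F \<and> (\<forall>f g \<eta>. f \<in> bounded_energy E \<longrightarrow> g \<in> bounded_energy E \<longrightarrow> 0 \<le> \<eta> \<longrightarrow>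
      (\<forall>x\<in>F. \<bar>ball_average M f x R - ball_average M g x R\<bar> \<le> \<eta>) \<longrightarrow>
      (\<integral>y. \<bar>f y - g y\<bar> \<partial>M) \<le> (2 * R + \<eta>) * L + 2 * K * E * R powr (dw - 1))"
proof -
  obtain F where F: "finite F" "(\<Union>x\<in>F. ball x R) = UNIV" "(\<Sum>x\<in>F. measure M (ball x R)) \<le> L"
    and net: "\<And>f. f \<in> bounded_energy E \<Longrightarrow>
      (\<Sum>x\<in>F. \<integral>\<^sup>+y\<in>ball x R. ennreal ((f y - ball_average M f x R)\<^sup>2) \<partial>M) \<le> ennreal (K * R powr dw * E)"
    using bounded_energy_net[OF R E] by blast
  show ?thesis
  proof (intro exI[of _ F] conjI allI impI F(1))
    fix f g \<eta> assume f: "f \<in> bounded_energy E" and g: "g \<in> bounded_energy E" and \<eta>: "0 \<le> \<eta>"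
      and close: "\<forall>x\<in>F. \<bar>ball_average M f x R - ball_average M g x R\<bar> \<le> \<eta>"
    note [measurable] = bounded_energyD(3)[OF f] bounded_energyD(3)[OF g]
    let ?a = "\<lambda>f x. ball_average M f x R"
    let ?I = "\<lambda>f x y. ennreal ((f y - ?a f x)\<^sup>2) * indicator (ball x R) y"
    have "(\<integral>\<^sup>+y. ennreal \<bar>f y - g y\<bar> \<partial>M) \<le>
      (\<integral>\<^sup>+y. (\<Sum>x\<in>F. ennreal (2 * R + \<eta>) * indicator (ball x R) y + ennreal (1 / R) * (?I f x y + ?I g x y)) \<partial>M)"
    proof (rule nn_integral_mono)
      fix y
      obtain x where x: "x \<in> F" "y \<in> ball x R"
        using F(2) by blast
      \<comment> \<open>The weight \<open>1 / R\<close> turns the squared oscillation, of order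
        \<open>R powr dw\<close>, into \<open>R powr (dw - 1)\<close>, at the price of an error
        \<open>R\<close> times the volume; both vanish with \<open>R\<close>.\<close>
      have young: "\<bar>t\<bar> \<le> R + 1 / R * t\<^sup>2" for t
      proof -
        have "0 \<le> R * \<bar>t\<bar>"
          using R by simp
        then have "R * \<bar>t\<bar> \<le> R\<^sup>2 + t\<^sup>2"
          using sum_squares_bound[of R "\<bar>t\<bar>"] unfolding power2_abs mult.assoc by linarith
        then have "R * \<bar>t\<bar> \<le> R * (R + 1 / R * t\<^sup>2)"
          using R by (simp add: distrib_left power2_eq_square)
        then show ?thesis
          using R by (rule mult_left_le_imp_le)
      qed
      have "\<bar>f y - g y\<bar> \<le> \<bar>f y - ?a f x\<bar> + \<bar>g y - ?a g x\<bar> + \<bar>?a f x - ?a g x\<bar>"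
        by linarith
      also have "\<dots> \<le> (R + 1 / R * (f y - ?a f x)\<^sup>2) + (R + 1 / R * (g y - ?a g x)\<^sup>2) + \<eta>"
        by (intro add_mono young close[rule_format] x)
      also have "\<dots> = (2 * R + \<eta>) + 1 / R * ((f y - ?a f x)\<^sup>2 + (g y - ?a g x)\<^sup>2)"
        by (simp add: algebra_simps)
      finally have "ennreal \<bar>f y - g y\<bar> \<le> ennreal ((2 * R + \<eta>) + 1 / R * ((f y - ?a f x)\<^sup>2 + (g y - ?a g x)\<^sup>2))"
        by (rule ennreal_leI)
      also have "\<dots> = ennreal (2 * R + \<eta>) + ennreal (1 / R) * (ennreal ((f y - ?a f x)\<^sup>2) + ennreal ((g y - ?a g x)\<^sup>2))"
        using R \<eta> by (simp only: ennreal_plus ennreal_mult add_nonneg_nonneg mult_nonneg_nonneg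
            zero_le_power2 less_imp_le zero_le_numeral divide_nonneg_nonneg zero_le_one)
      also have "\<dots> = ennreal (2 * R + \<eta>) * indicator (ball x R) y + ennreal (1 / R) * (?I f x y + ?I g x y)"
        using x by simp
      also have "\<dots> \<le> (\<Sum>x\<in>F. ennreal (2 * R + \<eta>) * indicator (ball x R) y + ennreal (1 / R) * (?I f x y + ?I g x y))"
        using F(1) x by (intro member_le_sum) auto
      finally show "ennreal \<bar>f y - g y\<bar> \<le> \<dots>" .
    qed
    also have "\<dots> = ennreal (2 * R + \<eta>) * (\<Sum>x\<in>F. emeasure M (ball x R)) +
        ennreal (1 / R) * ((\<Sum>x\<in>F. \<integral>\<^sup>+y. ?I f x y \<partial>M) + (\<Sum>x\<in>F. \<integral>\<^sup>+y. ?I g x y \<partial>M))"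
      by (simp add: nn_integral_sum nn_integral_add nn_integral_cmult sum.distrib flip: sum_distrib_left)
    also have "\<dots> \<le> ennreal (2 * R + \<eta>) * ennreal L +
        ennreal (1 / R) * (ennreal (K * R powr dw * E) + ennreal (K * R powr dw * E))"
      using F(3) by (intro add_mono mult_left_mono net f g) (auto simp: emeasure_eq_measure sum_nonneg intro: ennreal_leI)
    also have "\<dots> = ennreal ((2 * R + \<eta>) * L + 1 / R * (K * R powr dw * E + K * R powr dw * E))"
      using R \<eta> L_nonneg K_pos E by (simp flip: ennreal_plus ennreal_mult)
    also have "1 / R * (K * R powr dw * E + K * R powr dw * E) = 2 * K * E * R powr (dw - 1)"
      using R by (simp add: powr_diff field_simps)
    finally have le: "(\<integral>\<^sup>+y. ennreal \<bar>f y - g y\<bar> \<partial>M) \<le> ennreal ((2 * R + \<eta>) * L + 2 * K * E * R powr (dw - 1))" .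
    have "(\<integral>y. \<bar>f y - g y\<bar> \<partial>M) = enn2real (\<integral>\<^sup>+y. ennreal \<bar>f y - g y\<bar> \<partial>M)"
      by (rule integral_eq_nn_integral) auto
    also have "\<dots> \<le> (2 * R + \<eta>) * L + 2 * K * E * R powr (dw - 1)"
      using le R \<eta> L_nonneg K_pos E by (intro enn2real_leI) auto
    finally show "(\<integral>y. \<bar>f y - g y\<bar> \<partial>M) \<le> (2 * R + \<eta>) * L + 2 * K * E * R powr (dw - 1)" .
  qed
qed

text \<open>All averages over the nets of radii \<open>1 / 2 ^ k\<close> form one point of a product
  of compact intervals, so compactness of the product replaces a diagonal argument.\<close>

lemma bounded_energy_L1_Cauchy_subseq:
  fixes f :: "nat \<Rightarrow> 'a \<Rightarrow> real"
  assumes E: "0 \<le> E" and f: "\<And>n. f n \<in> bounded_energy E"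
  shows "\<exists>s :: nat \<Rightarrow> nat. strict_mono s \<and>
    (\<forall>e>0. \<exists>N. \<forall>i\<ge>N. \<forall>j\<ge>N. (\<integral>x. \<bar>f (s i) x - f (s j) x\<bar> \<partial>M) < e)"
proof -
  obtain A where A: "\<And>n x k. \<bar>ball_average M (f n) x (1 / 2 ^ k)\<bar> \<le> A * q ^ k"
    using ball_average_bound[OF E] f by meson
  define P where "P k F \<longleftrightarrow> finite F \<and> (\<forall>g h \<eta>. g \<in> bounded_energy E \<longrightarrow> h \<in> bounded_energy E \<longrightarrow> 0 \<le> \<eta> \<longrightarrow>
      (\<forall>x\<in>F. \<bar>ball_average M g x (1 / 2 ^ k) - ball_average M h x (1 / 2 ^ k)\<bar> \<le> \<eta>) \<longrightarrow>
      (\<integral>y. \<bar>g y - h y\<bar> \<partial>M) \<le> (2 * (1 / 2 ^ k) + \<eta>) * L + 2 * K * E * (1 / 2 ^ k) powr (dw - 1))"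
    for k :: nat and F
  have "\<exists>F. P k F" for k
  proof -
    have "0 < (1 / 2 ^ k :: real)"
      by simp
    from L1_distance_estimate[OF this E] show ?thesis
      unfolding P_def by blast
  qed
  then obtain F where P: "\<And>k. P k (F k)"
    by metis
  have F: "finite (F k)" for k
    using P[of k] by (simp add: P_def)
  have estimate: "(\<integral>y. \<bar>g y - h y\<bar> \<partial>M) \<le> (2 * (1 / 2 ^ k) + \<eta>) * L + 2 * K * E * (1 / 2 ^ k) powr (dw - 1)"
    if "g \<in> bounded_energy E" "h \<in> bounded_energy E" "0 \<le> \<eta>"
      "\<And>x. x \<in> F k \<Longrightarrow> \<bar>ball_average M g x (1 / 2 ^ k) - ball_average M h x (1 / 2 ^ k)\<bar> \<le> \<eta>" for k g h \<eta>
    using P[of k] that by (simp add: P_def)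
  \<comment> \<open>The index \<open>i\<close> enumerates the finite net \<open>F k\<close>, with
    repetitions. The countable index type keeps the product first countable, so compactness gives
    convergent subsequences.\<close>
  define a where "a n = (\<lambda>(k, i). ball_average M (f n) (from_nat_into (F k) i) (1 / 2 ^ k))" for n
  define S :: "(nat \<times> nat \<Rightarrow> real) set" where "S = PiE UNIV (\<lambda>(k, i). {- (A * q ^ k)..A * q ^ k})"
  have "compactin (product_topology (\<lambda>_. euclidean) UNIV) S"
    unfolding S_def compactin_PiE by auto
  then have "compact S"
    by (simp add: euclidean_product_topology)
  moreover have "\<forall>n. a n \<in> S"
    using A by (auto simp: S_def a_def abs_le_iff minus_le_iff)
  ultimately obtain l s where s: "strict_mono (s :: nat \<Rightarrow> nat)" "(a \<circ> s) \<longlonglongrightarrow> l"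
    using compact_imp_seq_compact seq_compactE by metis
  have conv: "\<exists>N. \<forall>i\<ge>N. \<forall>j\<ge>N. \<forall>x\<in>F k.
      \<bar>ball_average M (f (s i)) x (1 / 2 ^ k) - ball_average M (f (s j)) x (1 / 2 ^ k)\<bar> \<le> \<eta>"
    if "0 < \<eta>" for k \<eta>
  proof -
    have "\<forall>x\<in>F k. \<exists>N. \<forall>i\<ge>N. \<forall>j\<ge>N.
      \<bar>ball_average M (f (s i)) x (1 / 2 ^ k) - ball_average M (f (s j)) x (1 / 2 ^ k)\<bar> < \<eta>"
    proof
      fix x assume "x \<in> F k"
      then obtain i where i: "from_nat_into (F k) i = x"
        using F countable_finite from_nat_into_surj by metis
      have "(\<lambda>n. (a \<circ> s) n (k, i)) \<longlonglongrightarrow> l (k, i)"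
        by (rule continuous_on_tendsto_compose[OF continuous_on_product_coordinates s(2)]) auto
      then have "Cauchy (\<lambda>n. ball_average M (f (s n)) x (1 / 2 ^ k))"
        by (auto simp: a_def i intro: LIMSEQ_imp_Cauchy)
      then show "\<exists>N. \<forall>i\<ge>N. \<forall>j\<ge>N.
          \<bar>ball_average M (f (s i)) x (1 / 2 ^ k) - ball_average M (f (s j)) x (1 / 2 ^ k)\<bar> < \<eta>"
        using that unfolding Cauchy_def dist_real_def by blast
    qed
    then obtain N where N: "\<And>x i j. x \<in> F k \<Longrightarrow> N x \<le> i \<Longrightarrow> N x \<le> j \<Longrightarrow>
        \<bar>ball_average M (f (s i)) x (1 / 2 ^ k) - ball_average M (f (s j)) x (1 / 2 ^ k)\<bar> < \<eta>"
      by metis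
    show ?thesis
    proof (intro exI[of _ "Max (N ` F k)"] allI impI ballI)
      fix i j x assume ij: "Max (N ` F k) \<le> i" "Max (N ` F k) \<le> j" and x: "x \<in> F k"
      then have "N x \<le> i" "N x \<le> j"
        using order_trans[OF Max_ge[of "N ` F k" "N x"]] F[of k] by auto
      from N[OF x this] show "\<bar>ball_average M (f (s i)) x (1 / 2 ^ k) - ball_average M (f (s j)) x (1 / 2 ^ k)\<bar> \<le> \<eta>"
        by simp
    qed
  qed
  show ?thesis
  proof (intro exI[of _ s] conjI allI impI s(1))
    fix e :: real assume e: "0 < e"
    \<comment> \<open>The estimate with both \<open>R\<close> and \<open>\<eta>\<close> equal to
      \<open>1 / 2 ^ k\<close>; it tends to 0 because \<open>dw > 1\<close>.\<close>
    let ?b = "\<lambda>k::nat. (2 * (1 / 2 ^ k) + 1 / 2 ^ k) * L + 2 * K * E * (1 / (2 powr (dw - 1)) ^ k)"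
    have "?b \<longlonglongrightarrow> (2 * 0 + 0) * L + 2 * K * E * 0"
      using dw by (intro tendsto_intros LIMSEQ_divide_realpow_zero) auto
    then have "eventually (\<lambda>k. ?b k < e) sequentially"
      using e by (intro order_tendstoD(2)) auto
    then obtain k where k: "?b k < e"
      by (auto simp: eventually_sequentially)
    obtain N where N: "\<And>i j x. N \<le> i \<Longrightarrow> N \<le> j \<Longrightarrow> x \<in> F k \<Longrightarrow>
      \<bar>ball_average M (f (s i)) x (1 / 2 ^ k) - ball_average M (f (s j)) x (1 / 2 ^ k)\<bar> \<le> 1 / 2 ^ k"
      using conv[of "1 / 2 ^ k" k] by auto
    show "\<exists>N. \<forall>i\<ge>N. \<forall>j\<ge>N. (\<integral>x. \<bar>f (s i) x - f (s j) x\<bar> \<partial>M) < e"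
    proof (intro exI[of _ N] allI impI)
      fix i j assume "N \<le> i" "N \<le> j"
      then have "(\<integral>x. \<bar>f (s i) x - f (s j) x\<bar> \<partial>M) \<le> ?b k"
        using estimate[of "f (s i)" "f (s j)" "1 / 2 ^ k" k, OF f f _ N] unfolding half_power_powr by simp
      with k show "(\<integral>x. \<bar>f (s i) x - f (s j) x\<bar> \<partial>M) < e"
        by simp
    qed
  qed
qed

end

section \<open>Extraction of the subsequence\<close>

theorem theorem4p2:
  fixes M :: "'a::metric_space measure"
    and dw Q :: real
    and f :: "nat \<Rightarrow> 'a \<Rightarrow> real"
  assumes "dw > 2"
    and "compact (UNIV :: 'a set)"
    and "radon_measure M"
    and "positive_doubling M"
    and "0 < Q"
    and "volume_growth_exponent M Q"
    and "ks_poincare M dw"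
    and "Q > dw"
    and "\<And>n. f n \<in> ks_space M dw"
    and "(SUP n. ennreal (Lp_norm M 2 (f n)) +
            Liminf (at_right 0) (ks_energy M dw UNIV (f n))) < \<infinity>"
  shows "\<exists>s :: nat \<Rightarrow> nat. strict_mono s \<and>
           (\<forall>\<alpha>::real. 1 \<le> \<alpha> \<and> \<alpha> < 2 * Q / (Q - dw) \<longrightarrow>
              converges_in_Lp M \<alpha> (\<lambda>k. f (s k)))"
proof -
  have sets: "sets M = sets borel" and finite: "emeasure M UNIV < \<infinity>"
    using assms(2,3) by (auto simp: radon_measure_def)
  have space: "space M = UNIV"
    using sets_eq_imp_space_eq[OF sets] by simp
  interpret finite_measure M
    using finite by (intro finite_measureI) (simp add: space)
  have ball_pos: "0 < measure M (ball x r)" if "0 < r" for x r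
  proof -
    \<comment> \<open>Positivity is stated for doubled radii, so it is applied at
      \<open>r / 2\<close>.\<close>
    have "0 < emeasure M (ball x (2 * (r / 2)))"
      using assms(4) that unfolding positive_doubling_def by (meson half_gt_zero)
    then show ?thesis
      by (simp add: emeasure_eq_measure)
  qed
  obtain G where "0 < G" and G: "\<And>x r R. 0 < r \<Longrightarrow> r \<le> R \<Longrightarrow>
      measure M (ball x R) / measure M (ball x r) \<le> G * (R / r) powr Q"
    using assms(6) unfolding volume_growth_exponent_def by blast
  interpret ball_growth_space M Q G
  proof
    fix r R :: real and x assume r: "0 < r" "r \<le> R"
    then show "measure M (ball x R) \<le> G * (R / r) powr Q * measure M (ball x r)"
      using G[OF r, of x] ball_pos[of r x] by (simp add: divide_le_eq)
  qed (use sets assms(2) ball_pos \<open>0 < G\<close> in auto)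
  obtain K L where "poincare_net_space M Q G dw K L"
    using ks_poincare_imp_net[OF assms(7)] assms(1,8) by auto
  then interpret poincare_net_space M Q G dw K L .
  obtain b where b: "0 \<le> b" "(SUP n. ennreal (Lp_norm M 2 (f n)) +
      Liminf (at_right 0) (ks_energy M dw UNIV (f n))) = ennreal b"
    using assms(10) by (cases "SUP n. ennreal (Lp_norm M 2 (f n)) +
      Liminf (at_right 0) (ks_energy M dw UNIV (f n))") auto
  \<comment> \<open>\<open>b\<close> bounds the norm as well as the energy, whereas
    \<open>bounded_energy\<close> asks for a bound on the squared norm.\<close>
  define E where "E = max b (b\<^sup>2)"
  have E: "0 \<le> E"
    using b by (simp add: E_def)
  have f: "f n \<in> bounded_energy E" for n
  proof -
    have le: "ennreal (Lp_norm M 2 (f n)) + Liminf (at_right 0) (ks_energy M dw UNIV (f n)) \<le> ennreal b"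
      unfolding b(2)[symmetric] by (rule SUP_upper) simp
    have L2: "f n \<in> Lp_space M 2"
      using assms(9) by (simp add: ks_space_def)
    have "ennreal (Lp_norm M 2 (f n)) \<le> ennreal b"
      using le by (rule order_trans[rotated]) simp
    then have "sqrt (\<integral>x. (f n x)\<^sup>2 \<partial>M) \<le> b"
      using b(1) by (simp add: Lp_norm_def powr_half_sqrt integral_nonneg_AE)
    then have "(\<integral>x. (f n x)\<^sup>2 \<partial>M) \<le> b\<^sup>2"
      by (rule sqrt_le_D)
    then have "(\<integral>\<^sup>+x. ennreal ((f n x)\<^sup>2) \<partial>M) \<le> ennreal E"
      using Lp_space_2_integrable[OF L2]
      by (subst nn_integral_eq_integral) (auto simp: E_def intro!: ennreal_leI)
    moreover have "Liminf (at_right 0) (ks_energy M dw UNIV (f n)) \<le> ennreal b"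
      using le by (rule order_trans[rotated]) simp
    then have "Liminf (at_right 0) (ks_energy M dw UNIV (f n)) \<le> ennreal E"
      by (rule order_trans) (simp add: E_def ennreal_leI)
    ultimately show ?thesis
      using assms(9) by (simp add: bounded_energy_def)
  qed
  obtain s0 :: "nat \<Rightarrow> nat" where s0: "strict_mono s0" and
    L1: "\<forall>e>0. \<exists>N. \<forall>i\<ge>N. \<forall>j\<ge>N. (\<integral>x. \<bar>f (s0 i) x - f (s0 j) x\<bar> \<partial>M) < e"
    using bounded_energy_L1_Cauchy_subseq[of E f, OF E f] by blast
  \<comment> \<open>A further subsequence is Cauchy almost everywhere. It is chosen before
    \<open>\<alpha>\<close>, so a single subsequence serves all exponents; only \<open>p\<close> and
    \<open>B\<close> depend on \<open>\<alpha>\<close>.\<close>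
  obtain s1 :: "nat \<Rightarrow> nat" where s1: "strict_mono s1" and Cauchy: "AE x in M. Cauchy (\<lambda>i. f (s0 (s1 i)) x)"
    by (rule cauchy_L1_AE_cauchy_subseq[of M "\<lambda>n. f (s0 n)"])
      (use L1 bounded_energyD(4)[OF f] in \<open>simp_all add: real_norm_def\<close>)
  show ?thesis
  proof (intro exI[of _ "s0 \<circ> s1"] conjI allI impI)
    show "strict_mono (s0 \<circ> s1)"
      using s0 s1 by (rule strict_mono_o)
    fix \<alpha> :: real assume \<alpha>: "1 \<le> \<alpha> \<and> \<alpha> < 2 * Q / (Q - dw)"
    have "2 < 2 * Q / (Q - dw)"
      using assms(1,8) by (simp add: field_simps)
    then obtain p where p: "max 2 \<alpha> < p" "p < 2 * Q / (Q - dw)"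
      using \<alpha> dense[of "max 2 \<alpha>" "2 * Q / (Q - dw)"] by auto
    then obtain B where B: "\<And>n. (\<integral>\<^sup>+x. ennreal (\<bar>f n x\<bar> powr p) \<partial>M) \<le> ennreal B"
      using Lp_bound[OF E, of p] f by auto
    show "converges_in_Lp M \<alpha> (\<lambda>k. f ((s0 \<circ> s1) k))"
      using \<alpha> p Cauchy bounded_energyD(3)[OF f] B
      by (intro AE_Cauchy_imp_converges_in_Lp[where p=p and B=B] finite_measure_axioms) auto
  qed
qed

end
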